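(* Let $\{F_n\}_{n\in\mathbb{N}}$ be the sequence of Fibonacci numbers. There exist constants $c_1,c_2>0$ and an integer $N_0$ such that for all integers $N\geq N_0$, $$c_1\frac{N}{\log\log N}\leq \#\left\{n\leq N : \text{every prime } p\mid F_n \text{ satisfies } p>\tfrac12(\log N)(\log\log N)\right\}\leq c_2\frac{N}{\log\log\log N}.$$
   Context: $F_n=\frac{\phi^n-(-\phi)^{-n}}{\sqrt5}$ for $n\geq 1$, where $\phi=\frac{1+\sqrt5}{2}$ is the golden ratio. In the counted set $n$ ranges over positive integers. *)

theory Defs
  imports "HOL-Number_Theory.Number_Theory"
begin

text \<open>The library's \<^const>\<open>fib\<close> is the sequence given by the Binet formula with golden ratio \<open>\<phi>\<close>:\<close>

lemma fib_binet:
  fixes \<phi> :: real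
  defines "\<phi> \<equiv> (1 + sqrt 5) / 2"
  shows "real (fib n) = (\<phi> ^ n - (- \<phi>) powi (- int n)) / sqrt 5"
proof -
  have "1 + sqrt 5 > 0" by (intro add_pos_pos) auto
  then have "inverse (- \<phi>) = (1 - sqrt 5) / 2"
    by (simp add: \<phi>_def field_simps)
  then have "(- \<phi>) powi (- int n) = ((1 - sqrt 5) / 2) ^ n"
    by (simp only: power_int_minus power_int_of_nat power_inverse [symmetric])
  then show ?thesis
    by (simp add: fib_closed_form \<phi>_def)
qed

end

theory Submission
  imports Defs "HOL-Analysis.Harmonic_Numbers" "HOL-Real_Asymp.Real_Asymp"
begin

text \<open>
  Let \<open>z = (log N) (log log N) / 2\<close>.

  Every prime \<open>p\<close> divides some \<open>F\<^sub>m\<close> with \<open>1 \<le> m \<le> p + 1\<close>, and \<open>gcd(F\<^sub>m, F\<^sub>n) = F\<^bsub>gcd(m, n)\<^esub>\<close>.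
  Hence if \<open>n\<close> has no prime factor up to \<open>z + 1\<close>, then \<open>F\<^sub>n\<close> has no prime factor up to \<open>z\<close>.
  By Chebyshev's bound, \<open>2\<^bsup>\<pi>(z + 1)\<^esup>\<close> is at most a power of \<open>N\<close> with exponent below 1, so
  Legendre's sieve suffices to count such \<open>n\<close>, and by Mertens' theorem there are at least a
  constant times \<open>N / log z\<close> of them.

  Conversely, an odd prime \<open>q\<close> with \<open>2\<^sup>q \<le> z\<close> cannot divide \<open>n\<close> if \<open>F\<^sub>n\<close> has no prime factor
  up to \<open>z\<close>, because \<open>F\<^sub>q\<close> divides \<open>F\<^sub>n\<close> and \<open>1 < F\<^sub>q \<le> 2\<^sup>q\<close>. Sieving by the odd primes up to
  \<open>log\<^sub>2 z\<close> leaves at most a constant times \<open>N / log log z\<close> integers.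
\<close>

section \<open>Legendre's sieve\<close>

definition sifted :: "nat \<Rightarrow> nat set \<Rightarrow> nat set" where
  "sifted x P = {n \<in> {1..x}. \<forall>p\<in>P. \<not> p dvd n}"

lemma finite_sifted [simp]: "finite (sifted x P)"
  by (simp add: sifted_def)

lemma real_nat_div_bounds:
  "real n / real k - 1 \<le> real (n div k)" "real (n div k) \<le> real n / real k"
proof -
  have "real_of_int \<lfloor>real n / real k\<rfloor> = real (n div k)"
    by (simp add: floor_divide_of_nat_eq)
  then show "real n / real k - 1 \<le> real (n div k)" "real (n div k) \<le> real n / real k"
    by linarith+
qed

lemma prod_one_minus_inverse_bounds:
  assumes "\<And>p. p \<in> P \<Longrightarrow> prime (p::nat)"
  shows "0 \<le> (\<Prod>p\<in>P. 1 - 1 / real p)" "(\<Prod>p\<in>P. 1 - 1 / real p) \<le> 1"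
proof -
  have "1 / real p \<le> 1" if "p \<in> P" for p
    using prime_ge_1_nat[OF assms[OF that]] by simp
  then show "0 \<le> (\<Prod>p\<in>P. 1 - 1 / real p)" "(\<Prod>p\<in>P. 1 - 1 / real p) \<le> 1"
    by (auto intro!: prod_nonneg prod_le_1)
qed

text \<open>Split by divisibility by \<open>p\<close>: the multiples are \<open>p * m\<close> with
  \<open>m \<le> x div p\<close>, and as \<open>p\<close> is coprime to every sieving prime,
  \<open>m\<close> meets the same conditions as \<open>p * m\<close>.\<close>

lemma card_sifted_insert:
  assumes P: "\<And>q. q \<in> P \<Longrightarrow> prime q" and p: "prime p" "p \<notin> P"
  shows "card (sifted x P) = card (sifted x (insert p P)) + card (sifted (x div p) P)"
proof -
  have p0: "p > 0" using p prime_gt_0_nat by blast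
  have dvd: "q dvd p * m \<longleftrightarrow> q dvd m" if "q \<in> P" for q m
  proof -
    have "coprime q p" using P[OF that] p that primes_coprime by metis
    then show ?thesis by (simp add: coprime_dvd_mult_right_iff)
  qed
  have "sifted x P = sifted x (insert p P) \<union> (*) p ` sifted (x div p) P"
  proof (intro equalityI subsetI)
    fix n assume n: "n \<in> sifted x P"
    show "n \<in> sifted x (insert p P) \<union> (*) p ` sifted (x div p) P"
    proof (cases "p dvd n")
      case True
      then obtain m where m: "n = p * m" by blast
      have "m \<in> sifted (x div p) P"
        using n m p0 dvd by (auto simp: sifted_def less_eq_div_iff_mult_less_eq mult.commute)
      then show ?thesis using m by blast
    qed (use n in \<open>auto simp: sifted_def\<close>)
  next
    fix n assume "n \<in> sifted x (insert p P) \<union> (*) p ` sifted (x div p) P"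
    then show "n \<in> sifted x P"
      using p0 dvd by (auto simp: sifted_def less_eq_div_iff_mult_less_eq mult.commute)
  qed
  moreover have "sifted x (insert p P) \<inter> (*) p ` sifted (x div p) P = {}"
    by (auto simp: sifted_def)
  moreover have "card ((*) p ` sifted (x div p) P) = card (sifted (x div p) P)"
    by (rule card_image) (use p0 in \<open>auto simp: inj_on_def\<close>)
  ultimately show ?thesis
    by (simp add: card_Un_disjoint)
qed

text \<open>Adding a prime combines two instances of the error bound E with one rounding of
  \<open>x / p\<close>, so E becomes 2E + 1; starting from 0 this gives
  \<open>2 ^ card P - 1\<close>.\<close>

theorem legendre_sieve:
  assumes "finite P" "\<And>p. p \<in> P \<Longrightarrow> prime p"
  shows "\<bar>real (card (sifted x P)) - real x * (\<Prod>p\<in>P. 1 - 1 / real p)\<bar> \<le> 2 ^ card P - 1"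
  using assms
proof (induction P arbitrary: x rule: finite_induct)
  case empty
  have "sifted x {} = {1..x}" by (auto simp: sifted_def)
  then show ?case by simp
next
  case (insert p P)
  define \<pi> where "\<pi> = (\<Prod>p\<in>P. 1 - 1 / real p)"
  have p0: "p > 0" using insert.prems prime_gt_0_nat by blast
  have \<pi>: "0 \<le> \<pi>" "\<pi> \<le> 1"
    unfolding \<pi>_def using insert.prems by (auto intro!: prod_one_minus_inverse_bounds)
  have "\<bar>real (x div p) - real x / real p\<bar> \<le> 1"
    using real_nat_div_bounds[of x p] by linarith
  then have "\<bar>real (x div p) - real x / real p\<bar> * \<pi> \<le> 1 * 1"
    using \<pi> by (intro mult_mono) auto
  then have round: "\<bar>real (x div p) * \<pi> - real x / real p * \<pi>\<bar> \<le> 1"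
    using \<pi>(1) by (simp only: left_diff_distrib [symmetric] abs_mult abs_of_nonneg mult_1_right)
  have IH: "\<bar>real (card (sifted y P)) - real y * \<pi>\<bar> \<le> 2 ^ card P - 1" for y
    unfolding \<pi>_def using insert.prems by (intro insert.IH) auto
  have "real (card (sifted x (insert p P))) = real (card (sifted x P)) - real (card (sifted (x div p) P))"
    using card_sifted_insert[of P p x] insert.prems insert.hyps by simp
  moreover have "(\<Prod>q\<in>insert p P. 1 - 1 / real q) = (1 - 1 / real p) * \<pi>"
    using insert.hyps by (simp add: \<pi>_def)
  moreover have "real x * ((1 - 1 / real p) * \<pi>) = real x * \<pi> - real x / real p * \<pi>"
    by (simp add: left_diff_distrib right_diff_distrib)
  moreover have "2 ^ card (insert p P) = 2 * (2::real) ^ card P"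
    using insert.hyps by simp
  ultimately show ?case
    using IH[of x] IH[of "x div p"] round by (simp only: abs_le_iff) argo
qed

text \<open>A truncated Euler product. A multiple of \<open>p\<close> in the sum is
  \<open>p * k\<close> with \<open>k\<close> again in its range, so the sum S' for
  \<open>insert p P\<close> and the sum S for \<open>P\<close> satisfy S' <= S + S' / p.\<close>

lemma sum_inverse_smooth_le:
  assumes "finite P" "\<And>p. p \<in> P \<Longrightarrow> prime (p::nat)"
  shows "(\<Sum>m | m \<in> {1..x} \<and> prime_factors m \<subseteq> P. 1 / real m) * (\<Prod>p\<in>P. 1 - 1 / real p) \<le> 1"
  using assms
proof (induction P rule: finite_induct)
  case empty
  have "(\<Sum>m | m \<in> {1..x} \<and> prime_factors m \<subseteq> {}. 1 / real m) \<le> (\<Sum>m\<in>{1::nat}. 1 / real m)"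
    by (rule sum_mono2) (auto simp: prime_factorization_empty_iff)
  then show ?case by simp
next
  case (insert p P)
  define M where "M Q = {m. m \<in> {1..x} \<and> prime_factors m \<subseteq> Q}" for Q :: "nat set"
  define S where "S Q = (\<Sum>m\<in>M Q. 1 / real m)" for Q
  have fin: "finite (M Q)" for Q by (simp add: M_def)
  have p: "prime p" and p0: "p > 0" using insert.prems prime_gt_0_nat by blast+
  \<comment> \<open>Only an inclusion, since \<open>p * m\<close> may exceed \<open>x\<close>; it
    suffices because all terms are nonnegative.\<close>
  have sub: "M (insert p P) \<subseteq> M P \<union> (*) p ` M (insert p P)"
  proof
    fix m assume m: "m \<in> M (insert p P)"
    show "m \<in> M P \<union> (*) p ` M (insert p P)"
    proof (cases "p dvd m")
      case True
      then obtain k where k: "m = p * k" by blast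
      have "k > 0" "m > 0" using k m by (auto simp: M_def)
      have "k \<le> m" using k p0 by simp
      moreover have "prime_factors k \<subseteq> prime_factors m"
        using k \<open>m > 0\<close> by (intro dvd_prime_factors) auto
      ultimately have "k \<in> M (insert p P)" using m \<open>k > 0\<close> by (auto simp: M_def)
      then show ?thesis using k by blast
    next
      case False
      then have "p \<notin> prime_factors m" by auto
      then show ?thesis using m by (auto simp: M_def)
    qed
  qed
  have "S (insert p P) \<le> (\<Sum>m\<in>M P \<union> (*) p ` M (insert p P). 1 / real m)"
    unfolding S_def by (rule sum_mono2) (use sub fin in auto)
  also have "\<dots> \<le> S P + (\<Sum>m\<in>(*) p ` M (insert p P). 1 / real m)"
    unfolding S_def by (subst sum_Un) (auto simp: fin sum_nonneg)
  also have "(\<Sum>m\<in>(*) p ` M (insert p P). 1 / real m) = S (insert p P) / real p"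
    unfolding S_def by (subst sum.reindex) (use p0 in \<open>auto simp: inj_on_def sum_divide_distrib mult.commute\<close>)
  finally have "S (insert p P) * (1 - 1 / real p) \<le> S P"
    by (simp add: algebra_simps)
  then have "S (insert p P) * (1 - 1 / real p) * (\<Prod>p\<in>P. 1 - 1 / real p) \<le> S P * (\<Prod>p\<in>P. 1 - 1 / real p)"
    using insert.prems by (intro mult_right_mono prod_one_minus_inverse_bounds) auto
  also have "\<dots> \<le> 1"
    using insert.IH insert.prems by (simp add: S_def M_def)
  finally show ?case
    using insert.hyps by (simp add: S_def M_def mult.assoc)
qed

section \<open>Chebyshev and Mertens bounds\<close>

definition primes_le :: "nat \<Rightarrow> nat set" where
  "primes_le n = {p. prime p \<and> p \<le> n}"

lemma finite_primes_le [simp]: "finite (primes_le n)"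
  by (rule finite_subset[of _ "{..n}"]) (auto simp: primes_le_def)

lemma prime_primes_le: "p \<in> primes_le n \<Longrightarrow> prime p"
  by (simp add: primes_le_def)

lemma primes_le_Suc:
  "primes_le (Suc n) = (if prime (Suc n) then insert (Suc n) (primes_le n) else primes_le n)"
  by (auto simp: primes_le_def le_Suc_eq)

lemma primes_le_less_2: "n < 2 \<Longrightarrow> primes_le n = {}"
  by (auto simp: primes_le_def dest: prime_ge_2_nat)

text \<open>The prime factors of every \<open>m \<le> n\<close> are at most \<open>n\<close>, so the
  smooth sum is the full harmonic sum, which is at least \<open>ln (n + 1)\<close>.\<close>

theorem mertens_product_upper:
  "ln (real n + 1) * (\<Prod>p\<in>primes_le n. 1 - 1 / real p) \<le> 1"
proof -
  have "prime_factors m \<subseteq> primes_le n" if "m \<in> {1..n}" for m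
  proof
    fix p assume "p \<in> prime_factors m"
    then have "prime p" "p dvd m" by auto
    moreover have "p \<le> m" using \<open>p dvd m\<close> that by (intro dvd_imp_le) auto
    ultimately show "p \<in> primes_le n" using that by (simp add: primes_le_def)
  qed
  then have "{m. m \<in> {1..n} \<and> prime_factors m \<subseteq> primes_le n} = {1..n}" by blast
  then have "harm n * (\<Prod>p\<in>primes_le n. 1 - 1 / real p) \<le> 1"
    using sum_inverse_smooth_le[of "primes_le n" n] prime_primes_le
    by (simp add: harm_def inverse_eq_divide)
  moreover have "ln (real n + 1) * (\<Prod>p\<in>primes_le n. 1 - 1 / real p)
      \<le> harm n * (\<Prod>p\<in>primes_le n. 1 - 1 / real p)"
    using prime_primes_le by (intro mult_right_mono ln_le_harm prod_one_minus_inverse_bounds)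
  ultimately show ?thesis by linarith
qed

lemma prod_dvd_coprime:
  fixes f :: "'b \<Rightarrow> nat"
  assumes "finite A" "\<And>a. a \<in> A \<Longrightarrow> f a dvd n"
    and "\<And>a b. a \<in> A \<Longrightarrow> b \<in> A \<Longrightarrow> a \<noteq> b \<Longrightarrow> coprime (f a) (f b)"
  shows "prod f A dvd n"
  using assms
proof (induction A rule: finite_induct)
  case (insert a A)
  have "coprime (f a) (prod f A)"
    using insert.hyps insert.prems(2) by (intro prod_coprime_right) (metis insertCI)
  then show ?case
    using insert by (simp add: divides_mult)
qed simp

text \<open>This coefficient occurs twice, at \<open>m\<close> and \<open>m + 1\<close>, in a row
  with sum \<open>2 * 4 ^ m\<close>.\<close>

lemma central_binomial_odd_le: "(2 * m + 1) choose m \<le> 4 ^ m"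
proof -
  have "2 * ((2 * m + 1) choose m) = (\<Sum>k\<in>{m, m + 1}. (2 * m + 1) choose k)"
    using binomial_symmetric[of m "2 * m + 1"] by simp
  also have "\<dots> \<le> (\<Sum>k\<le>2 * m + 1. (2 * m + 1) choose k)"
    by (rule sum_mono2) auto
  also have "\<dots> = 2 * 4 ^ m"
    by (simp only: choose_row_sum) (simp add: power_mult)
  finally show ?thesis by simp
qed

text \<open>Erdos's induction: for \<open>n = 2 * m + 1\<close> the primes in (m + 1, n] all divide
  \<open>n choose m \<le> 4 ^ m\<close>, and the primes up to \<open>m + 1\<close> fall under the
  induction hypothesis.\<close>

theorem primorial_le: "\<Prod>(primes_le n) \<le> 4 ^ n"
proof (induction n rule: less_induct)
  case (less n)
  consider "n < 2" | "n = 2" | "n > 2" "even n" | "n > 2" "odd n" by linarith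
  then show ?case
  proof cases
    case 1
    then show ?thesis by (simp add: primes_le_less_2)
  next
    case 2
    have "primes_le 2 = {2}"
      by (auto simp: primes_le_def dest: prime_ge_2_nat)
    with 2 show ?thesis by simp
  next
    case 3
    then obtain m where m: "n = Suc m" by (cases n) auto
    have "\<not> prime n" using 3 prime_odd_nat by blast
    then have "primes_le n = primes_le m" using primes_le_Suc[of m] m by simp
    then have "\<Prod>(primes_le n) \<le> 4 ^ m" using less.IH[of m] m by simp
    also have "\<dots> \<le> 4 ^ n" using m by simp
    finally show ?thesis .
  next
    case 4
    then obtain m where m: "n = 2 * m + 1" "m \<ge> 1" by (auto elim!: oddE)
    define Q where "Q = {p. prime p \<and> m + 1 < p \<and> p \<le> n}"
    have "finite Q" by (rule finite_subset[of _ "{..n}"]) (auto simp: Q_def)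
    have "p dvd (n choose m)" if "p \<in> Q" for p
    proof -
      have p: "prime p" "m + 1 < p" "p \<le> n" using that by (auto simp: Q_def)
      have "n - m = m + 1" using m by simp
      then have "fact m * fact (m + 1) * (n choose m) = fact n"
        using binomial_fact_lemma[of m n] m by simp
      moreover have "p dvd fact n" "\<not> p dvd fact m" "\<not> p dvd fact (m + 1)"
        using p by (simp_all only: prime_dvd_fact_iff)
      ultimately show ?thesis using p(1) by (metis prime_dvd_mult_iff)
    qed
    then have "\<Prod>Q dvd (n choose m)"
      using \<open>finite Q\<close> by (intro prod_dvd_coprime) (auto simp: Q_def primes_coprime)
    then have "\<Prod>Q \<le> (n choose m)" using m by (intro dvd_imp_le) auto
    also have "\<dots> \<le> 4 ^ m" unfolding m(1) by (rule central_binomial_odd_le)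
    finally have Q: "\<Prod>Q \<le> 4 ^ m" .
    have "primes_le n = primes_le (m + 1) \<union> Q" "primes_le (m + 1) \<inter> Q = {}"
      using m by (auto simp: primes_le_def Q_def)
    then have "\<Prod>(primes_le n) = \<Prod>(primes_le (m + 1)) * \<Prod>Q"
      using \<open>finite Q\<close> by (simp add: prod.union_disjoint)
    also have "\<dots> \<le> 4 ^ (m + 1) * 4 ^ m"
      using m by (intro mult_mono less.IH Q) auto
    also have "\<dots> = 4 ^ n" by (simp add: m flip: power_add)
    finally show ?thesis .
  qed
qed

lemma sum_ln_primes_le: "(\<Sum>p\<in>primes_le n. ln (real p)) \<le> real n * ln 4"
proof -
  have pos: "p > 0" if "p \<in> primes_le n" for p
    using prime_primes_le[OF that] prime_gt_0_nat by blast
  then have "(\<Sum>p\<in>primes_le n. ln (real p)) = ln (\<Prod>p\<in>primes_le n. real p)"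
    by (intro ln_prod [symmetric]) auto
  also have "\<dots> = ln (real (\<Prod>(primes_le n)))" by simp
  also have "\<dots> \<le> ln (real (4 ^ n))"
  proof (rule ln_mono)
    show "0 < real (\<Prod>(primes_le n))" using pos by (simp add: prod_pos)
    show "real (\<Prod>(primes_le n)) \<le> real (4 ^ n)" using primorial_le by (simp only: of_nat_le_iff)
  qed
  also have "\<dots> = real n * ln 4" by (simp add: ln_realpow)
  finally show ?thesis .
qed

text \<open>Each of the \<open>k\<close> multiples of \<open>p\<close> up to \<open>p * k\<close>
  contributes a factor \<open>p\<close>.\<close>

lemma power_dvd_fact_mult:
  assumes "p > 0"
  shows "p ^ k dvd (fact (p * k) :: nat)"
proof (induction k)
  case (Suc k)
  have "p * Suc k = Suc (p * Suc k - 1)" using assms by simp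
  then have "fact (p * Suc k) = p * Suc k * (fact (p * Suc k - 1) :: nat)"
    by (metis fact_Suc of_nat_id)
  moreover have "p ^ k dvd fact (p * Suc k - 1)"
    using Suc assms by (rule_tac dvd_trans[OF Suc fact_dvd]) simp
  ultimately show ?case by (simp add: mult_dvd_mono)
qed simp

text \<open>Comparing \<open>n!\<close> with the prime powers dividing it.\<close>

theorem mertens_first_upper:
  assumes "n \<ge> 1"
  shows "(\<Sum>p\<in>primes_le n. ln (real p) / real p) \<le> ln (real n) + ln 4"
proof -
  have pos: "p \<ge> 1" if "p \<in> primes_le n" for p
    using prime_primes_le[OF that] prime_ge_1_nat by blast
  have "(\<Prod>p\<in>primes_le n. p ^ (n div p)) dvd fact n"
  proof (rule prod_dvd_coprime)
    show "p ^ (n div p) dvd fact n" if "p \<in> primes_le n" for p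
      using pos[OF that] by (intro dvd_trans[OF power_dvd_fact_mult fact_dvd]) auto
    show "coprime (p ^ (n div p)) (q ^ (n div q))"
      if "p \<in> primes_le n" "q \<in> primes_le n" "p \<noteq> q" for p q
    proof -
      have "coprime p q" using that prime_primes_le primes_coprime by blast
      then show ?thesis by simp
    qed
  qed simp
  then have "(\<Prod>p\<in>primes_le n. p ^ (n div p)) \<le> fact n" by (rule dvd_imp_le) simp
  also have "\<dots> \<le> n ^ n" using fact_le_power[of n, where 'a = nat] by simp
  finally have le: "real (\<Prod>p\<in>primes_le n. p ^ (n div p)) \<le> real (n ^ n)"
    by (simp only: of_nat_le_iff)
  \<comment> \<open>Removing the floor costs \<open>ln p\<close> per prime, in total at most
    \<open>n * ln 4\<close>; this is the source of the summand \<open>ln 4\<close>.\<close>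
  have "(\<Sum>p\<in>primes_le n. real n * (ln p / p) - ln p) \<le> (\<Sum>p\<in>primes_le n. real (n div p) * ln p)"
  proof (rule sum_mono)
    fix p assume "p \<in> primes_le n"
    then have "(real n / real p - 1) * ln p \<le> real (n div p) * ln p"
      using pos by (intro mult_right_mono real_nat_div_bounds) auto
    then show "real n * (ln p / p) - ln p \<le> real (n div p) * ln p"
      by (simp add: left_diff_distrib)
  qed
  also have "\<dots> = ln (\<Prod>p\<in>primes_le n. real p ^ (n div p))"
    using pos by (subst ln_prod) (fastforce simp: ln_realpow)+
  also have "\<dots> = ln (real (\<Prod>p\<in>primes_le n. p ^ (n div p)))" by simp
  also have "\<dots> \<le> ln (real (n ^ n))"
    using pos le by (intro ln_mono) (auto simp: prod_pos Suc_le_eq)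
  also have "\<dots> = real n * ln n" using assms by (simp add: ln_realpow)
  finally have "real n * (\<Sum>p\<in>primes_le n. ln p / p) - (\<Sum>p\<in>primes_le n. ln p) \<le> real n * ln n"
    by (simp add: sum_subtractf sum_distrib_left)
  then have "real n * (\<Sum>p\<in>primes_le n. ln p / p) \<le> real n * (ln n + ln 4)"
    using sum_ln_primes_le[of n] by (simp add: distrib_left)
  then show ?thesis using assms by simp
qed

lemma ln_4_eq: "ln (4::real) = 2 * ln 2"
  using ln_realpow[of "2::real" 2] by simp

text \<open>Abel summation as an induction: the increments of the right-hand side absorb
  those of the left because \<open>1 - a / b \<le> ln (b / a)\<close> for \<open>a = ln n\<close> and \<open>b = ln (n + 1)\<close>.\<close>

theorem mertens_second_upper:
  assumes "n \<ge> 2"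
  shows "(\<Sum>p\<in>primes_le n. 1 / real p) \<le> ln (ln (real n)) + (3 - ln (ln 2))"
proof -
  define S where "S n = (\<Sum>p\<in>primes_le n. 1 / real p)" for n
  define A where "A n = (\<Sum>p\<in>primes_le n. ln (real p) / real p)" for n
  have A: "A n \<le> ln (real n) + ln 4" if "n \<ge> 2" for n
    unfolding A_def using that by (intro mertens_first_upper) auto
  \<comment> \<open>Partial summation gives A(n) / ln n plus the integral of A(t) / (t (ln t)^2)
    from 2 to n; the other terms are that integral with A(t) replaced by its bound ln t + ln
    4.\<close>
  have "S n \<le> A n / ln n + ln (ln n) - ln (ln 2) + ln 4 * (1 / ln 2 - 1 / ln n)"
    using assms
  proof (induction n rule: dec_induct)
    case base
    have "primes_le 2 = {2}"
      by (auto simp: primes_le_def dest: prime_ge_2_nat)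
    then show ?case by (simp add: S_def A_def)
  next
    case (step n)
    define a b where "a = ln (real n)" and "b = ln (real (Suc n))"
    have ab: "0 < a" "a \<le> b" using step.hyps by (auto simp: a_def b_def)
    define \<delta> where "\<delta> = (if prime (Suc n) then 1 / real (Suc n) else 0)"
    have S: "S (Suc n) = S n + \<delta>" and A': "A (Suc n) = A n + b * \<delta>"
      by (auto simp: S_def A_def \<delta>_def b_def primes_le_Suc) (auto simp: primes_le_def)
    have "ln (a / b) \<le> a / b - 1" using ab by (intro ln_le_minus_one) auto
    then have ln_ratio: "1 - a / b \<le> ln b - ln a" using ab by (simp add: ln_div)
    have "1 / b \<le> 1 / a" using ab by (simp add: frac_le)
    then have "A n * (1 / a - 1 / b) \<le> (a + ln 4) * (1 / a - 1 / b)"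
      using A[of n] step.hyps by (intro mult_right_mono) (auto simp: a_def)
    also have "\<dots> = 1 - a / b + ln 4 * (1 / a - 1 / b)"
      using ab by (simp add: field_simps)
    finally have "A n / a + \<delta> + ln a - ln 4 / a \<le> (A n + b * \<delta>) / b + ln b - ln 4 / b"
      using ln_ratio ab by (simp add: add_divide_distrib right_diff_distrib)
    then show ?case
      using step.IH S A' by (simp add: right_diff_distrib del: of_nat_Suc flip: a_def b_def)
  qed
  also have "A n / ln n \<le> (ln n + ln 4) / ln n"
    using A[OF assms] assms by (intro divide_right_mono) auto
  \<comment> \<open>The terms \<open>ln 4 / ln n\<close> cancel, and 3 is 1 from the first quotient
    plus \<open>ln 4 / ln 2 = 2\<close>.\<close>
  also have "(ln n + ln 4) / ln n + ln (ln n) - ln (ln 2) + ln 4 * (1 / ln 2 - 1 / ln n)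
      = ln (ln n) + (3 - ln (ln 2))"
    using assms by (simp add: field_simps ln_4_eq)
  finally show ?thesis by (simp add: S_def)
qed

text \<open>The differences 1 / (p - 1) - 1 / p are among the terms of a sum over all integers that
  telescopes to \<open>1 - 1 / n\<close>.\<close>

lemma sum_inverse_primes_pred_le:
  assumes "n \<ge> 1"
  shows "(\<Sum>p\<in>primes_le n. 1 / real (p - 1)) \<le> (\<Sum>p\<in>primes_le n. 1 / real p) + 1"
proof -
  have "(\<Sum>p\<in>primes_le n. 1 / real (p - 1)) - (\<Sum>p\<in>primes_le n. 1 / real p) \<le> 1 - 1 / real n"
    using assms
  proof (induction n rule: dec_induct)
    case base
    then show ?case by (simp add: primes_le_less_2)
  next
    case (step n)
    then have "1 / real (Suc n) \<le> 1 / real n" by (simp add: frac_le)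
    moreover have "Suc n \<notin> primes_le n" by (simp add: primes_le_def)
    ultimately show ?case using step.IH by (simp add: primes_le_Suc)
  qed
  also have "\<dots> \<le> 1" by simp
  finally show ?thesis by simp
qed

text \<open>Since \<open>1 - 1 / p\<close> is the inverse of
  \<open>1 + 1 / (p - 1) \<le> exp (1 / (p - 1))\<close>, a bound on the sum of 1 / (p - 1) bounds
  the product from below.\<close>

theorem mertens_product_lower:
  "\<exists>c>0. \<forall>n\<ge>2. c / ln (real n) \<le> (\<Prod>p\<in>primes_le n. 1 - 1 / real p)"
proof (intro exI conjI allI impI)
  fix n :: nat assume n: "n \<ge> 2"
  have p2: "p \<ge> 2" if "p \<in> primes_le n" for p
    using prime_primes_le[OF that] by (rule prime_ge_2_nat)
  \<comment> \<open>The 4 is the 3 from the sum of 1 / p plus the 1 lost in passing from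
    \<open>p\<close> to \<open>p - 1\<close>.\<close>
  have "exp (ln (ln 2) - 4) / ln (real n) = exp (- (ln (ln (real n)) + (3 - ln (ln 2)) + 1))"
    using n by (simp add: exp_diff exp_add exp_minus field_simps)
  also have "\<dots> \<le> exp (- (\<Sum>p\<in>primes_le n. 1 / real (p - 1)))"
    using sum_inverse_primes_pred_le[of n] mertens_second_upper[OF n] n by simp
  also have "\<dots> = (\<Prod>p\<in>primes_le n. exp (- (1 / real (p - 1))))"
    by (simp add: exp_sum flip: sum_negf)
  also have "\<dots> \<le> (\<Prod>p\<in>primes_le n. 1 - 1 / real p)"
  proof (intro prod_mono conjI)
    fix p assume "p \<in> primes_le n"
    then have p: "real p > 1" "real (p - 1) = real p - 1" using p2[of p] by auto
    have "1 + 1 / (real p - 1) \<le> exp (1 / (real p - 1))" by (rule exp_ge_add_one_self)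
    then have "inverse (exp (1 / (real p - 1))) \<le> inverse (1 + 1 / (real p - 1))"
      using p by (intro le_imp_inverse_le) (auto intro: add_pos_nonneg)
    also have "\<dots> = 1 - 1 / real p" using p by (simp add: field_simps)
    finally show "exp (- (1 / real (p - 1))) \<le> 1 - 1 / real p"
      by (simp only: exp_minus p)
  qed simp
  finally show "exp (ln (ln 2) - 4) / ln (real n) \<le> (\<Prod>p\<in>primes_le n. 1 - 1 / real p)" .
qed simp

text \<open>Primes up to n^(3/4) are counted trivially; each larger one adds at least
  \<open>3/4 * ln n\<close> to a sum of logarithms bounded by \<open>n * ln 4\<close>. With
  \<open>ln 4 \<le> 3/2\<close> the quotient of the constants is 2.\<close>

theorem card_primes_le_upper:
  assumes "n \<ge> 2"
  shows "real (card (primes_le n)) \<le> real n powr (3/4) + 2 * real n / ln (real n)"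
proof -
  define y where "y = real n powr (3/4)"
  define l where "l = 3/4 * ln (real n)"
  define Q where "Q = {p \<in> primes_le n. real p > y}"
  define R where "R = {p \<in> primes_le n. real p \<le> y}"
  have l: "l > 0" using assms by (simp add: l_def)
  have pos: "p \<ge> 1" if "p \<in> primes_le n" for p
    using prime_primes_le[OF that] prime_ge_1_nat by blast
  have fin: "finite Q" "finite R" by (simp_all add: Q_def R_def)
  have "card R \<le> card {1..nat \<lfloor>y\<rfloor>}"
    by (rule card_mono) (use pos in \<open>auto simp: R_def le_nat_iff le_floor_iff\<close>)
  then have R: "real (card R) \<le> y" by (simp add: y_def le_nat_iff le_floor_iff)
  have "real (card Q) * l = (\<Sum>p\<in>Q. l)" by simp
  also have "\<dots> \<le> (\<Sum>p\<in>Q. ln (real p))"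
  proof (rule sum_mono)
    fix p assume "p \<in> Q"
    then have "ln y \<le> ln (real p)" using assms by (intro ln_mono) (auto simp: Q_def y_def)
    then show "l \<le> ln (real p)" using assms by (simp add: y_def l_def ln_powr)
  qed
  also have "\<dots> \<le> (\<Sum>p\<in>primes_le n. ln (real p))"
    by (rule sum_mono2) (use pos in \<open>auto simp: Q_def\<close>)
  also have "\<dots> \<le> real n * ln 4" by (rule sum_ln_primes_le)
  also have "\<dots> \<le> real n * (3 / 2)"
    using ln2_le_25_over_36 by (intro mult_left_mono) (auto simp: ln_4_eq)
  finally have "real (card Q) \<le> 2 * real n / ln (real n)"
    using assms l by (simp add: l_def field_simps)
  moreover have "primes_le n = Q \<union> R" "Q \<inter> R = {}" by (auto simp: Q_def R_def)
  then have "card (primes_le n) = card Q + card R" using fin by (simp add: card_Un_disjoint)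
  ultimately show ?thesis using R by (simp add: y_def)
qed

section \<open>Prime divisors of Fibonacci numbers\<close>

text \<open>By the recurrence, raising \<open>i\<close> by one only flips the sign. If a prime
  divides the left-hand side, it therefore divides \<open>fib d\<close>.\<close>

lemma fib_dOcagne:
  "int (fib (i + d)) * int (fib (Suc i)) - int (fib (Suc (i + d))) * int (fib i) = (-1) ^ i * int (fib d)"
proof (induction i)
  case (Suc i)
  have "int (fib (Suc i + d)) * int (fib (Suc (Suc i))) - int (fib (Suc (Suc i + d))) * int (fib (Suc i))
      = - (int (fib (i + d)) * int (fib (Suc i)) - int (fib (Suc (i + d))) * int (fib i))"
    by (simp add: algebra_simps)
  then show ?case using Suc by simp
qed simp

text \<open>If no \<open>fib m\<close> with \<open>m \<le> p + 1\<close> vanishes modulo \<open>p\<close>, then two of the \<open>p + 1\<close> ratios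
  \<open>fib (m + 1) / fib m\<close> agree modulo \<open>p\<close>, and d'Ocagne's identity gives a contradiction.\<close>

theorem prime_dvd_fib_le_Suc:
  assumes p: "prime p"
  shows "\<exists>m\<in>{1..p+1}. p dvd fib m"
proof (rule ccontr)
  assume "\<not> ?thesis"
  then have ndvd: "\<not> p dvd fib m" if "m \<in> {1..p+1}" for m using that by blast
  \<comment> \<open>As \<open>fib k\<close> is invertible modulo \<open>p\<close>, the residue
    \<open>c\<close> represents the ratio of consecutive Fibonacci numbers.\<close>
  have "\<exists>c<p. [c * fib k = fib (Suc k)] (mod p)" if "k \<in> {1..p+1}" for k
  proof -
    have "coprime (fib k) p"
      using ndvd[OF that] p by (metis prime_imp_coprime coprime_commute)
    then obtain x where "[fib k * x = 1] (mod p)" by (auto dest: cong_solve_coprime_nat)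
    then have "[fib k * x * fib (Suc k) = 1 * fib (Suc k)] (mod p)" by (rule cong_scalar_right)
    moreover have "[(x * fib (Suc k)) mod p * fib k = fib k * x * fib (Suc k)] (mod p)"
      using cong_scalar_right[of "x * fib (Suc k) mod p" "x * fib (Suc k)" p "fib k"]
      by (simp add: mult_ac)
    ultimately have "[(x * fib (Suc k)) mod p * fib k = fib (Suc k)] (mod p)"
      using cong_trans by fastforce
    then show ?thesis using prime_gt_0_nat[OF p] by (intro exI[of _ "x * fib (Suc k) mod p"]) auto
  qed
  then obtain c where c: "\<And>k. k \<in> {1..p+1} \<Longrightarrow> c k < p"
    "\<And>k. k \<in> {1..p+1} \<Longrightarrow> [c k * fib k = fib (Suc k)] (mod p)" by metis
  have "card (c ` {1..p+1}) \<le> card {..<p}" by (rule card_mono) (use c in auto)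
  then have "\<not> inj_on c {1..p+1}" by (intro pigeonhole) simp
  then obtain i j where ij: "i \<in> {1..p+1}" "j \<in> {1..p+1}" "i < j" "c i = c j"
    unfolding inj_on_def by (metis linorder_neqE_nat)
  define d where "d = j - i"
  have d: "j = i + d" "d \<in> {1..p+1}" using ij by (auto simp: d_def)
  define C where "C = int (c i)"
  have Ci: "[C * int (fib i) = int (fib (Suc i))] (mod int p)"
    using c(2)[OF ij(1)] by (simp add: C_def flip: cong_int_iff)
  have Cj: "[C * int (fib j) = int (fib (Suc j))] (mod int p)"
    using c(2)[OF ij(2)] ij(4) by (simp add: C_def flip: cong_int_iff)
  \<comment> \<open>The left-hand side is identically zero, because both ratios equal
    \<open>C\<close>.\<close>
  have "[int (fib j) * (C * int (fib i)) - (C * int (fib j)) * int (fib i)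
      = int (fib j) * int (fib (Suc i)) - int (fib (Suc j)) * int (fib i)] (mod int p)"
    by (intro cong_diff cong_mult Ci Cj cong_refl)
  then have "[0 = (-1) ^ i * int (fib d)] (mod int p)"
    using fib_dOcagne[of i d] d by (simp add: mult_ac)
  then have "int p dvd (-1) ^ i * int (fib d)"
    by (metis cong_0_iff cong_sym)
  then have "int p dvd int (fib d)"
    by (cases "even i") simp_all
  then have "p dvd fib d" by simp
  then show False using ndvd d(2) by blast
qed

text \<open>Some \<open>m \<le> p + 1 \<le> w\<close> has \<open>p dvd fib m\<close>. As
  \<open>n\<close> has no prime factor up to \<open>w\<close>, it is coprime to \<open>m\<close>, so
  \<open>p\<close> would divide \<open>fib 1 = 1\<close>.\<close>

lemma not_dvd_fib_of_sifted:
  assumes p: "prime p" "p < w" and n: "n \<in> sifted N (primes_le w)"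
  shows "\<not> p dvd fib n"
proof
  assume "p dvd fib n"
  obtain m where m: "1 \<le> m" "m \<le> p + 1" "p dvd fib m"
    using prime_dvd_fib_le_Suc[OF p(1)] by auto
  have "gcd m n = 1"
  proof (rule ccontr)
    assume "gcd m n \<noteq> 1"
    then obtain q where q: "prime q" "q dvd gcd m n" using prime_factor_nat by blast
    then have "q dvd m" "q dvd n" by auto
    then have "q \<le> w" using dvd_imp_le[of q m] m p by auto
    then show False using q \<open>q dvd n\<close> n by (auto simp: sifted_def primes_le_def)
  qed
  moreover have "p dvd fib (gcd m n)" using m \<open>p dvd fib n\<close> by (simp add: fib_gcd)
  ultimately show False using p by simp
qed

lemma fib_le_power_2: "fib n \<le> 2 ^ n"
  by (induction n rule: fib.induct) auto

lemma fib_dvd_fib: "m dvd n \<Longrightarrow> fib m dvd fib n"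
  using fib_gcd[of m n] by (metis gcd_dvd2 gcd_nat.absorb1)

text \<open>For \<open>q \<ge> 3\<close> the number \<open>fib q\<close> exceeds 1, so it has a
  prime factor, and that factor is at most \<open>fib q \<le> 2 ^ q\<close>.\<close>

lemma prime_dvd_fib_of_dvd:
  assumes "q dvd n" "q \<ge> 3"
  obtains p where "prime p" "p dvd fib n" "p \<le> 2 ^ q"
proof -
  have "fib 3 = 2" by (simp add: numeral_eq_Suc)
  then have "fib q \<ge> 2" using fib_mono[OF assms(2)] by simp
  then obtain p where p: "prime p" "p dvd fib q" using prime_factor_nat[of "fib q"] by auto
  have "p \<le> fib q" using p \<open>fib q \<ge> 2\<close> by (intro dvd_imp_le) auto
  then show ?thesis
    using that[of p] p fib_dvd_fib[OF assms(1)] fib_le_power_2[of q] by auto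
qed

section \<open>The two bounds\<close>

text \<open>With z = (ln x)(ln ln x) / 2, the quotient 2z / ln z is asymptotic to ln x and z^(3/4)
  is of smaller order. The exponential is thus x^(7/10 + o(1)), negligible against x / ln ln x;
  halving \<open>c\<close> absorbs all errors.\<close>

lemma sieve_lower_asymptotics:
  assumes "c > (0::real)"
  shows "\<forall>\<^sub>F x in at_top.
    c / 2 * (x / ln (ln x)) \<le> x * (c / ln (1 / 2 * ln x * ln (ln x) + 1))
      - exp (7/10 * ((1 / 2 * ln x * ln (ln x) + 1) powr (3/4)
          + 2 * (1 / 2 * ln x * ln (ln x) + 1) / ln (1 / 2 * ln x * ln (ln x))))"
  using assms by real_asymp

text \<open>For the same z, ln ln z is asymptotic to ln ln ln x, so doubling the constant 2 leaves
  room for the summand z.\<close>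

lemma sieve_upper_asymptotics:
  "\<forall>\<^sub>F x::real in at_top.
    x * (2 / ln (ln (1 / 2 * ln x * ln (ln x)))) + 1 / 2 * ln x * ln (ln x) \<le> 4 * (x / ln (ln (ln x)))"
  by real_asymp

definition fib_rough :: "nat \<Rightarrow> real \<Rightarrow> nat set" where
  "fib_rough N z = {n. 1 \<le> n \<and> n \<le> N \<and> (\<forall>p. prime p \<longrightarrow> p dvd fib n \<longrightarrow> real p > z)}"

lemma finite_fib_rough [simp]: "finite (fib_rough N z)"
  by (rule finite_subset[of _ "{..N}"]) (auto simp: fib_rough_def)

text \<open>Legendre's sieve with all primes up to some \<open>w\<close> in (z, z + 1]: the Mertens
  bound \<open>c\<close> gives the main term, and Chebyshev's bound with \<open>ln 2 < 7/10\<close>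
  controls the error \<open>2 ^ k\<close>.\<close>

lemma card_fib_rough_lower:
  assumes c: "c > 0" "\<And>n. n \<ge> 2 \<Longrightarrow> c / ln (real n) \<le> (\<Prod>p\<in>primes_le n. 1 - 1 / real p)"
    and z: "z > 1"
  shows "real N * (c / ln (z + 1)) - exp (7/10 * ((z + 1) powr (3/4) + 2 * (z + 1) / ln z))
    \<le> real (card (fib_rough N z))"
proof -
  \<comment> \<open>The added 1 makes every prime \<open>p \<le> z\<close> satisfy
    \<open>p + 1 \<le> w\<close>, as required by the index range
    \<open>m \<le> p + 1\<close>.\<close>
  define w where "w = nat \<lfloor>z\<rfloor> + 1"
  have w: "z < real w" "real w \<le> z + 1" using z unfolding w_def by linarith+
  have w2: "w \<ge> 2" using z unfolding w_def by linarith
  define k where "k = card (primes_le w)"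
  have "sifted N (primes_le w) \<subseteq> fib_rough N z"
  proof
    fix n assume n: "n \<in> sifted N (primes_le w)"
    have "real p > z" if "prime p" "p dvd fib n" for p
    proof (rule ccontr)
      assume "\<not> real p > z"
      then have "p < w" using w by linarith
      then show False using not_dvd_fib_of_sifted n that by blast
    qed
    then show "n \<in> fib_rough N z" using n by (auto simp: fib_rough_def sifted_def)
  qed
  then have "card (sifted N (primes_le w)) \<le> card (fib_rough N z)"
    by (intro card_mono) auto
  moreover have "\<bar>real (card (sifted N (primes_le w))) - real N * (\<Prod>p\<in>primes_le w. 1 - 1 / real p)\<bar>
      \<le> 2 ^ k - 1"
    unfolding k_def by (rule legendre_sieve) (auto simp: prime_primes_le)
  moreover have "real N * (c / ln (z + 1)) \<le> real N * (\<Prod>p\<in>primes_le w. 1 - 1 / real p)"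
  proof (intro mult_left_mono)
    have "c / ln (z + 1) \<le> c / ln (real w)"
      using c z w w2 by (intro divide_left_mono mult_pos_pos) auto
    then show "c / ln (z + 1) \<le> (\<Prod>p\<in>primes_le w. 1 - 1 / real p)"
      using c(2)[OF w2] by linarith
  qed simp
  moreover have "(2::real) ^ k \<le> exp (7/10 * ((z + 1) powr (3/4) + 2 * (z + 1) / ln z))"
  proof -
    have "real k \<le> real w powr (3/4) + 2 * real w / ln (real w)"
      unfolding k_def by (rule card_primes_le_upper[OF w2])
    also have "\<dots> \<le> (z + 1) powr (3/4) + 2 * (z + 1) / ln z"
      using z w by (intro add_mono powr_mono2 frac_le) auto
    finally have "real k \<le> (z + 1) powr (3/4) + 2 * (z + 1) / ln z" .
    then have "real k * ln 2 \<le> ((z + 1) powr (3/4) + 2 * (z + 1) / ln z) * (7/10)"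
      using ln2_le_25_over_36 by (intro mult_mono) auto
    then have "exp (real k * ln 2) \<le> exp (7/10 * ((z + 1) powr (3/4) + 2 * (z + 1) / ln z))"
      by (simp only: exp_le_cancel_iff mult.commute)
    then show ?thesis by (simp add: exp_of_nat_mult)
  qed
  ultimately show ?thesis by linarith
qed

text \<open>An odd prime \<open>q \<le> y\<close> dividing \<open>n\<close> would force a prime
  factor of \<open>fib n\<close> of size at most \<open>2 ^ y \<le> z\<close>, so all such
  \<open>q\<close> can be sieved out.\<close>

lemma card_fib_rough_upper:
  assumes z: "z \<ge> 4"
  shows "real (card (fib_rough N z)) \<le> real N * (2 / ln (ln z)) + z"
proof -
  define y where "y = nat \<lfloor>log 2 z\<rfloor>"
  \<comment> \<open>The prime 2 is left out because \<open>fib 2 = 1\<close>; its missing factor 1/2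
    is the source of the 2 in the bound.\<close>
  define Q where "Q = primes_le y - {2}"
  have "log 2 z \<ge> 2" using z by (simp add: le_log_iff)
  then have y: "real y \<le> log 2 z" "log 2 z < real y + 1" and y2: "y \<ge> 2"
    unfolding y_def by linarith+
  have "2 ^ y = 2 powr real y" by (simp add: powr_realpow)
  also have "\<dots> \<le> z" using y(1) z by (simp add: le_log_iff)
  finally have pow_y: "2 ^ y \<le> z" .
  have "ln z > 1" using z ln_less_cancel_iff[of "exp 1" z] exp_le by simp
  \<comment> \<open>Passing from base 2 to the natural logarithm gives
    \<open>ln z \<le> log 2 z < y + 1\<close>, so the Mertens bound at \<open>y\<close> can be
    stated with \<open>ln (ln z)\<close>.\<close>
  have "ln z * ln 2 \<le> ln z * 1" using \<open>ln z > 1\<close> ln_2_less_1 by (intro mult_left_mono) auto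
  then have "ln z \<le> log 2 z" by (simp add: log_def field_simps)
  then have ln_y: "ln (ln z) \<le> ln (real y + 1)" using y(2) \<open>ln z > 1\<close> by (intro ln_mono) auto
  have lnln: "ln (ln z) > 0" using \<open>ln z > 1\<close> by simp
  have prime: "prime p" if "p \<in> Q" for p
    using that by (auto simp: Q_def prime_primes_le)
  have "fib_rough N z \<subseteq> sifted N Q"
  proof
    fix n assume n: "n \<in> fib_rough N z"
    have "\<not> q dvd n" if q: "q \<in> Q" for q
    proof
      assume "q dvd n"
      have "q \<ge> 3" using prime_ge_2_nat[OF prime[OF q]] q by (auto simp: Q_def)
      then obtain p where p: "prime p" "p dvd fib n" "p \<le> 2 ^ q"
        using prime_dvd_fib_of_dvd \<open>q dvd n\<close> by blast
      have "real p \<le> real (2 ^ q)" using p(3) by (simp only: of_nat_le_iff)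
      also have "\<dots> = 2 ^ q" by simp
      also have "\<dots> \<le> 2 ^ y" using q by (intro power_increasing) (auto simp: Q_def primes_le_def)
      finally have "real p \<le> z" using pow_y by linarith
      moreover have "real p > z" using n p by (simp add: fib_rough_def)
      ultimately show False by linarith
    qed
    then show "n \<in> sifted N Q" using n by (auto simp: fib_rough_def sifted_def)
  qed
  then have "card (fib_rough N z) \<le> card (sifted N Q)" by (intro card_mono) auto
  moreover have "\<bar>real (card (sifted N Q)) - real N * (\<Prod>p\<in>Q. 1 - 1 / real p)\<bar> \<le> 2 ^ card Q - 1"
    by (rule legendre_sieve) (auto simp: Q_def prime_primes_le)
  moreover have "(2::real) ^ card Q \<le> z"
  proof -
    \<comment> \<open>The trivial count \<open>card Q \<le> y\<close> suffices, because
      \<open>y\<close> is only logarithmic in \<open>z\<close>.\<close>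
    have "Q \<subseteq> {1..y}"
      using prime_ge_1_nat by (auto simp: Q_def primes_le_def)
    then have "card Q \<le> card {1..y}" by (intro card_mono) auto
    then have "(2::real) ^ card Q \<le> 2 ^ y" by (intro power_increasing) auto
    then show ?thesis using pow_y by linarith
  qed
  moreover have "real N * (\<Prod>p\<in>Q. 1 - 1 / real p) \<le> real N * (2 / ln (ln z))"
  proof (intro mult_left_mono)
    have "2 \<in> primes_le y" using y2 by (simp add: primes_le_def)
    then have "(\<Prod>p\<in>primes_le y. 1 - 1 / real p) = 1 / 2 * (\<Prod>p\<in>Q. 1 - 1 / real p)"
      unfolding Q_def by (subst prod.remove[of _ 2]) auto
    then have two: "(\<Prod>p\<in>Q. 1 - 1 / real p) = 2 * (\<Prod>p\<in>primes_le y. 1 - 1 / real p)"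
      by linarith
    have "ln (ln z) * (\<Prod>p\<in>primes_le y. 1 - 1 / real p)
        \<le> ln (real y + 1) * (\<Prod>p\<in>primes_le y. 1 - 1 / real p)"
      using ln_y prime_primes_le by (intro mult_right_mono prod_one_minus_inverse_bounds)
    then have "ln (ln z) * (\<Prod>p\<in>Q. 1 - 1 / real p) \<le> 2"
      unfolding two using mertens_product_upper[of y] by linarith
    then show "(\<Prod>p\<in>Q. 1 - 1 / real p) \<le> 2 / ln (ln z)"
      using lnln by (simp add: field_simps)
  qed simp
  ultimately show ?thesis by linarith
qed

theorem corollary1p6:
  shows "\<exists>(c1::real) (c2::real) (N0::nat). c1 > 0 \<and> c2 > 0 \<and>
    (\<forall>N::nat. N \<ge> N0 \<longrightarrow>
      (let A = {n::nat. 1 \<le> n \<and> n \<le> N \<and>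
                 (\<forall>p::nat. prime p \<longrightarrow> p dvd fib n \<longrightarrow>
                    real p > 1 / 2 * ln (real N) * ln (ln (real N)))}
       in c1 * (real N / ln (ln (real N))) \<le> real (card A) \<and>
          real (card A) \<le> c2 * (real N / ln (ln (ln (real N))))))"
proof -
  obtain c :: real where c: "c > 0"
    "\<And>n. n \<ge> 2 \<Longrightarrow> c / ln (real n) \<le> (\<Prod>p\<in>primes_le n. 1 - 1 / real p)"
    using mertens_product_lower by blast
  define z where "z x = 1 / 2 * ln x * ln (ln x)" for x :: real
  \<comment> \<open>The threshold 4 is the one of the upper bound and also covers the condition
    \<open>z > 1\<close> of the lower bound.\<close>
  have "\<forall>\<^sub>F x in at_top. z x \<ge> 4" unfolding z_def by real_asymp
  then have "\<forall>\<^sub>F x in at_top.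
      c / 2 * (x / ln (ln x)) \<le> x * (c / ln (z x + 1))
        - exp (7/10 * ((z x + 1) powr (3/4) + 2 * (z x + 1) / ln (z x))) \<and>
      x * (2 / ln (ln (z x))) + z x \<le> 4 * (x / ln (ln (ln x))) \<and> z x \<ge> 4"
    unfolding z_def
    by (intro eventually_conj sieve_lower_asymptotics sieve_upper_asymptotics c)
  then have "\<forall>\<^sub>F N in sequentially.
      c / 2 * (real N / ln (ln (real N))) \<le> real N * (c / ln (z N + 1))
        - exp (7/10 * ((z N + 1) powr (3/4) + 2 * (z N + 1) / ln (z N))) \<and>
      real N * (2 / ln (ln (z N))) + z N \<le> 4 * (real N / ln (ln (ln (real N)))) \<and> z N \<ge> 4"
    by (rule eventually_compose_filterlim[OF _ filterlim_real_sequentially])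
  then have "\<forall>\<^sub>F N in sequentially.
      c / 2 * (real N / ln (ln (real N))) \<le> real (card (fib_rough N (z N))) \<and>
      real (card (fib_rough N (z N))) \<le> 4 * (real N / ln (ln (ln (real N))))"
  proof eventually_elim
    case (elim N)
    then show ?case
      using card_fib_rough_lower[OF c, of "z N" N] card_fib_rough_upper[of "z N" N] by linarith
  qed
  then obtain N0 where "\<forall>N\<ge>N0.
      c / 2 * (real N / ln (ln (real N))) \<le> real (card (fib_rough N (z N))) \<and>
      real (card (fib_rough N (z N))) \<le> 4 * (real N / ln (ln (ln (real N))))"
    unfolding eventually_sequentially by blast
  then show ?thesis
    using c(1) unfolding Let_def fib_rough_def z_def
    by (intro exI[of _ "c / 2"] exI[of _ 4] exI[of _ N0]) auto
qed

end
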